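(* Let $\mathcal{H}$ be a complex Hilbert space and let $f:\mathbb{D}\to\mathcal{B}(\mathcal{H})$ be a holomorphic map satisfying $\operatorname{Re} f(z)>0$ for all $z\in\mathbb{D}$. Then there is a net $\{f_\lambda\}$ of functions in the Herglotz class $\mathfrak{H}(\mathbb{D},\mathcal{B}(\mathcal{H}))$ such that, for each $\lambda$, $\operatorname{Re} f_\lambda(\zeta)=0$ for almost every $\zeta$ on the unit circle $\mathbb{T}$, and $f_\lambda\to f$ uniformly on compacta in $\mathbb{D}$ in the weak operator topology; that is, for all $h,k\in\mathcal{H}$ the net of scalar functions $z\mapsto\langle f_\lambda(z)h,k\rangle$ converges to $z\mapsto\langle f(z)h,k\rangle$ uniformly on every compact subset of $\mathbb{D}$.
   Context: $\mathbb{D}$ is the open unit disc in $\mathbb{C}$ and $\mathbb{T}$ its boundary circle, with "almost everywhere" referring to arc length. $\mathcal{B}(\mathcal{H})$ is the algebra of bounded operators on $\mathcal{H}$; for $A\in\mathcal{B}(\mathcal{H})$, $\operatorname{Re}A=(A+A^* )/2$, and $\operatorname{Re}A>0$ means $\langle(\operatorname{Re}A)h,h\rangle>0$ for all $h\neq0$. The Herglotz class $\mathfrak{H}(\mathbb{D},\mathcal{B}(\mathcal{H}))$ consists of all holomorphic $g:\mathbb{D}\to\mathcal{B}(\mathcal{H})$ with $\operatorname{Re}g(z)\ge0$ for all $z\in\mathbb{D}$. For $\zeta\in\mathbb{T}$, $f_\lambda(\zeta)$ denotes the boundary value of $f_\lambda$ at $\zeta$, i.e. the limit of $f_\lambda(r\zeta)$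 as $r\to1^-$ in the weak operator topology; part of the assertion is that this limit exists for almost every $\zeta$. *)

theory Defs
  imports "HOL-Analysis.Analysis"
begin

section \<open>Complex Hilbert spaces\<close>

text \<open>
  The real scaling and the norm of the underlying real normed space are tied to the complex
  scaling and to the inner product.  The inner product is linear in its first argument.
\<close>

class complex_hilbert_space = banach +
  fixes scaleC :: "complex \<Rightarrow> 'a \<Rightarrow> 'a" (infixr "*\<^sub>C" 75)
    and cinner :: "'a \<Rightarrow> 'a \<Rightarrow> complex"
  assumes scaleC_add_right: "c *\<^sub>C (x + y) = c *\<^sub>C x + c *\<^sub>C y"
    and scaleC_add_left: "(c + d) *\<^sub>C x = c *\<^sub>C x + d *\<^sub>C x"
    and scaleC_scaleC: "c *\<^sub>C (d *\<^sub>C x) = (c * d) *\<^sub>C x"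
    and scaleR_scaleC: "r *\<^sub>R x = complex_of_real r *\<^sub>C x"
    and cinner_commute: "cinner x y = cnj (cinner y x)"
    and cinner_add_left: "cinner (x + y) z = cinner x z + cinner y z"
    and cinner_scaleC_left: "cinner (c *\<^sub>C x) y = c * cinner x y"
    and cinner_self: "cinner x x = complex_of_real ((norm x)\<^sup>2)"

lemma cinner_scaleC_right: "cinner x (c *\<^sub>C y) = cnj c * cinner x y"
  by (metis cinner_commute cinner_scaleC_left complex_cnj_mult)

lemma norm_scaleC: "norm (c *\<^sub>C x) = cmod c * norm (x :: 'a :: complex_hilbert_space)"
proof -
  have "complex_of_real ((norm (c *\<^sub>C x))\<^sup>2) = c * cnj c * complex_of_real ((norm x)\<^sup>2)"
    by (simp only: cinner_self [symmetric] cinner_scaleC_left cinner_scaleC_right mult_ac)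
  also have "\<dots> = complex_of_real ((cmod c * norm x)\<^sup>2)"
    by (simp add: power_mult_distrib complex_norm_square [symmetric])
  finally have "(norm (c *\<^sub>C x))\<^sup>2 = (cmod c * norm x)\<^sup>2"
    by (simp only: of_real_eq_iff)
  then show ?thesis
    by (simp add: power2_eq_iff_nonneg)
qed

lemma bounded_linear_scaleC: "bounded_linear (\<lambda>x :: 'a :: complex_hilbert_space. c *\<^sub>C x)"
proof (rule bounded_linear_intro [where K = "cmod c"])
  fix x y :: 'a and r :: real
  show "c *\<^sub>C (x + y) = c *\<^sub>C x + c *\<^sub>C y"
    by (rule scaleC_add_right)
  show "c *\<^sub>C (r *\<^sub>R x) = r *\<^sub>R (c *\<^sub>C x)"
    by (simp add: scaleR_scaleC scaleC_scaleC mult.commute)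
  show "norm (c *\<^sub>C x) \<le> norm x * cmod c"
    by (simp add: norm_scaleC mult.commute)
qed


section \<open>Bounded operators\<close>

text \<open>
  The type of bounded real-linear operators, with its operator norm, is provided by the library;
  the bounded complex-linear operators form a closed subspace of it.
\<close>

definition bounded_ops :: "('a :: complex_hilbert_space \<Rightarrow>\<^sub>L 'a) set" where
  "bounded_ops = {A :: 'a \<Rightarrow>\<^sub>L 'a. \<forall>c x. A (c *\<^sub>C x) = c *\<^sub>C A x}"

lift_definition scaleC_op ::
    "complex \<Rightarrow> ('a :: complex_hilbert_space \<Rightarrow>\<^sub>L 'a) \<Rightarrow> 'a \<Rightarrow>\<^sub>L 'a"
  is "\<lambda>c A x. c *\<^sub>C A x"
  by (rule bounded_linear_compose [OF bounded_linear_scaleC])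

definition adjoint_op :: "('a :: complex_hilbert_space \<Rightarrow>\<^sub>L 'a) \<Rightarrow> 'a \<Rightarrow>\<^sub>L 'a" where
  "adjoint_op A = (THE B. B \<in> bounded_ops \<and> (\<forall>x y. cinner (A x) y = cinner x (B y)))"

definition Re_op :: "('a :: complex_hilbert_space \<Rightarrow>\<^sub>L 'a) \<Rightarrow> 'a \<Rightarrow>\<^sub>L 'a" where
  "Re_op A = (1 / 2) *\<^sub>R (A + adjoint_op A)"

definition nonneg_op :: "('a :: complex_hilbert_space \<Rightarrow>\<^sub>L 'a) \<Rightarrow> bool" where
  "nonneg_op A \<longleftrightarrow> (\<forall>h. cinner (A h) h \<in> \<real> \<and> Re (cinner (A h) h) \<ge> 0)"

definition positive_op :: "('a :: complex_hilbert_space \<Rightarrow>\<^sub>L 'a) \<Rightarrow> bool" where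
  "positive_op A \<longleftrightarrow> (\<forall>h. h \<noteq> 0 \<longrightarrow> cinner (A h) h \<in> \<real> \<and> Re (cinner (A h) h) > 0)"

definition wot_tendsto ::
    "('i \<Rightarrow> 'a :: complex_hilbert_space \<Rightarrow>\<^sub>L 'a) \<Rightarrow> ('a \<Rightarrow>\<^sub>L 'a) \<Rightarrow> 'i filter \<Rightarrow> bool" where
  "wot_tendsto F A net \<longleftrightarrow> (\<forall>h k. ((\<lambda>i. cinner (F i h) k) \<longlongrightarrow> cinner (A h) k) net)"


section \<open>Operator-valued functions on the disc\<close>

abbreviation unit_disc :: "complex set" where
  "unit_disc \<equiv> ball 0 1"

text \<open>Complex differentiability is with respect to the operator norm.\<close>

definition holomorphic_op_on ::
    "(complex \<Rightarrow> 'a :: complex_hilbert_space \<Rightarrow>\<^sub>L 'a) \<Rightarrow> complex set \<Rightarrow> bool" where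
  "holomorphic_op_on f S \<longleftrightarrow>
     (\<forall>z\<in>S. f z \<in> bounded_ops) \<and>
     (\<forall>z\<in>S. \<exists>A\<in>bounded_ops.
        ((\<lambda>w. scaleC_op (1 / (w - z)) (f w - f z)) \<longlongrightarrow> A) (at z within S))"

definition herglotz_class :: "(complex \<Rightarrow> 'a :: complex_hilbert_space \<Rightarrow>\<^sub>L 'a) set" where
  "herglotz_class =
     {g. holomorphic_op_on g unit_disc \<and> (\<forall>z\<in>unit_disc. nonneg_op (Re_op (g z)))}"

text \<open>Arc length on the unit circle, as a Borel measure on the plane.\<close>

definition arc_length :: "complex measure" where
  "arc_length = distr (restrict_space lborel {0..<2 * pi}) borel cis"

definition boundary_value ::
    "(complex \<Rightarrow> 'a :: complex_hilbert_space \<Rightarrow>\<^sub>L 'a) \<Rightarrow> complex \<Rightarrow> ('a \<Rightarrow>\<^sub>L 'a) \<Rightarrow> bool" where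
  "boundary_value f \<zeta> A \<longleftrightarrow>
     A \<in> bounded_ops \<and> wot_tendsto (\<lambda>r. f (complex_of_real r * \<zeta>)) A (at_left 1)"


section \<open>Nets\<close>

definition directed_set :: "'i set \<Rightarrow> ('i \<Rightarrow> 'i \<Rightarrow> bool) \<Rightarrow> bool" where
  "directed_set I le \<longleftrightarrow>
     I \<noteq> {} \<and>
     (\<forall>i\<in>I. le i i) \<and>
     (\<forall>i\<in>I. \<forall>j\<in>I. \<forall>k\<in>I. le i j \<longrightarrow> le j k \<longrightarrow> le i k) \<and>
     (\<forall>i\<in>I. \<forall>j\<in>I. \<exists>k\<in>I. le i k \<and> le j k)"

definition net_filter :: "'i set \<Rightarrow> ('i \<Rightarrow> 'i \<Rightarrow> bool) \<Rightarrow> 'i filter" where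
  "net_filter I le = (INF i\<in>I. principal {j \<in> I. le i j})"

lemma eventually_net_filter:
  assumes "directed_set I le"
  shows "eventually P (net_filter I le) \<longleftrightarrow> (\<exists>i\<in>I. \<forall>j\<in>I. le i j \<longrightarrow> P j)"
proof -
  have "eventually P (net_filter I le) \<longleftrightarrow>
      (\<exists>i\<in>I. eventually P (principal {j \<in> I. le i j}))"
    unfolding net_filter_def
  proof (rule eventually_INF_base)
    show "I \<noteq> {}"
      using assms by (simp add: directed_set_def)
    fix i j assume "i \<in> I" "j \<in> I"
    then obtain k where "k \<in> I" "le i k" "le j k"
      using assms unfolding directed_set_def by blast
    then have "{l \<in> I. le k l} \<subseteq> {l \<in> I. le i l} \<inter> {l \<in> I. le j l}"
      using assms \<open>i \<in> I\<close> \<open>j \<in> I\<close> unfolding directed_set_def by blast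
    then show "\<exists>k\<in>I. principal {l \<in> I. le k l} \<le>
        inf (principal {l \<in> I. le i l}) (principal {l \<in> I. le j l})"
      using \<open>k \<in> I\<close> by auto
  qed
  then show ?thesis
    by (auto simp: eventually_principal)
qed

definition wot_compactly_convergent ::
    "('i \<Rightarrow> complex \<Rightarrow> 'a :: complex_hilbert_space \<Rightarrow>\<^sub>L 'a) \<Rightarrow>
     (complex \<Rightarrow> 'a \<Rightarrow>\<^sub>L 'a) \<Rightarrow> 'i filter \<Rightarrow> bool" where
  "wot_compactly_convergent F f net \<longleftrightarrow>
     (\<forall>h k. \<forall>K. compact K \<and> K \<subseteq> unit_disc \<longrightarrow>
        uniform_limit K (\<lambda>i z. cinner (F i z h) k) (\<lambda>z. cinner (f z h) k) net)"

end

theory Submission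
  imports Defs "HOL-Complex_Analysis.Cauchy_Integral_Formula"
begin

text \<open>
  For \<open>0 < r < 1\<close> the Herglotz formula represents \<open>f (r z)\<close> as the skew-adjoint part of \<open>f 0\<close> plus the
  average over \<open>\<zeta>\<close> in the unit circle of \<open>((\<zeta> + z) / (\<zeta> - z)) Re f (r \<zeta>)\<close>.  Replacing the average by a
  Riemann sum over the \<open>n\<close>-th roots of unity gives a function in the Herglotz class whose real part
  vanishes on the circle off these finitely many points, since there the kernel is purely imaginary.
  The Riemann sums converge, weakly and uniformly on compacta, as \<open>n \<rightarrow> \<infinity>\<close>; then let \<open>r \<rightarrow> 1\<close>.  The
  net is indexed by a finite set of vectors and a precision, so that \<open>r\<close> and \<open>n\<close> need to be good for
  finitely many matrix coefficients at a time.
\<close>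

section \<open>Inner product and adjoints\<close>

lemma cinner_add_right: "cinner x (y + z) = cinner x y + cinner x (z :: 'a :: complex_hilbert_space)"
  by (metis cinner_add_left cinner_commute complex_cnj_add)

lemma cinner_scaleR_left: "cinner (r *\<^sub>R x) y = complex_of_real r * cinner x (y :: 'a :: complex_hilbert_space)"
  by (simp add: scaleR_scaleC cinner_scaleC_left)

lemma cinner_scaleR_right: "cinner x (r *\<^sub>R y) = complex_of_real r * cinner x (y :: 'a :: complex_hilbert_space)"
  by (simp add: scaleR_scaleC cinner_scaleC_right)

lemma cinner_minus_left: "cinner (- x) y = - cinner x (y :: 'a :: complex_hilbert_space)"
  using cinner_scaleR_left [of "-1" x y] by simp

lemma cinner_minus_right: "cinner x (- y) = - cinner x (y :: 'a :: complex_hilbert_space)"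
  using cinner_scaleR_right [of x "-1" y] by simp

lemma cinner_diff_left: "cinner (x - y) z = cinner x z - cinner y (z :: 'a :: complex_hilbert_space)"
  using cinner_add_left [of x "- y" z] by (simp add: cinner_minus_left)

lemma cinner_diff_right: "cinner x (y - z) = cinner x y - cinner x (z :: 'a :: complex_hilbert_space)"
  using cinner_add_right [of x y "- z"] by (simp add: cinner_minus_right)

lemma cinner_zero_left: "cinner 0 (y :: 'a :: complex_hilbert_space) = 0"
  using cinner_scaleR_left [of 0 0 y] by simp

lemma cinner_zero_right: "cinner (x :: 'a :: complex_hilbert_space) 0 = 0"
  using cinner_scaleR_right [of x 0 0] by simp

lemma cinner_sum_left:
  "cinner (\<Sum>i\<in>S. u i) (y :: 'a :: complex_hilbert_space) = (\<Sum>i\<in>S. cinner (u i) y)"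
  by (induction S rule: infinite_finite_induct) (auto simp: cinner_zero_left cinner_add_left)

lemma norm_add_sq:
  fixes x y :: "'a :: complex_hilbert_space"
  shows "(norm (x + y))\<^sup>2 = (norm x)\<^sup>2 + 2 * Re (cinner x y) + (norm y)\<^sup>2"
proof -
  have "complex_of_real ((norm (x + y))\<^sup>2) = cinner x x + cinner x y + cnj (cinner x y) + cinner y y"
    by (simp only: cinner_self [symmetric] cinner_add_left cinner_add_right cinner_commute [of y x])
      (simp add: algebra_simps)
  also have "\<dots> = complex_of_real ((norm x)\<^sup>2 + 2 * Re (cinner x y) + (norm y)\<^sup>2)"
    by (simp add: cinner_self complex_eq_iff)
  finally show ?thesis
    by (simp only: of_real_eq_iff)
qed

lemma norm_diff_sq:
  fixes x y :: "'a :: complex_hilbert_space"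
  shows "(norm (x - y))\<^sup>2 = (norm x)\<^sup>2 - 2 * Re (cinner x y) + (norm y)\<^sup>2"
  using norm_add_sq [of x "- y"] by (simp add: cinner_minus_right)

text \<open>The squared norm of \<open>norm y *\<^sub>R x - norm x *\<^sub>R y\<close> is twice
  \<open>norm x * norm y\<close> times the gap in the inequality. When that factor vanishes, one of
  the vectors is zero.\<close>

lemma Re_cinner_le: "Re (cinner x y) \<le> norm x * norm (y :: 'a :: complex_hilbert_space)"
proof -
  have "(norm (norm y *\<^sub>R x - norm x *\<^sub>R y))\<^sup>2
      = 2 * ((norm x * norm y) * (norm x * norm y - Re (cinner x y)))"
    unfolding norm_diff_sq
    by (simp add: cinner_scaleR_left cinner_scaleR_right power2_eq_square algebra_simps)
  then have "0 \<le> 2 * ((norm x * norm y) * (norm x * norm y - Re (cinner x y)))"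
    using zero_le_power2 [of "norm (norm y *\<^sub>R x - norm x *\<^sub>R y)"] by (simp only:)
  then have "0 \<le> (norm x * norm y) * (norm x * norm y - Re (cinner x y))"
    by linarith
  moreover have "Re (cinner x y) = 0" if "norm x * norm y = 0"
    using that by (auto simp: cinner_zero_left cinner_zero_right)
  ultimately show ?thesis
    by (metis diff_ge_0_iff_ge less_eq_real_def mult_pos_neg norm_ge_zero not_le
        mult_nonneg_nonneg)
qed

text \<open>Multiplying \<open>x\<close> by the unimodular scalar \<open>c\<close> turns the inner
  product into its modulus, which reduces the bound to \<open>Re_cinner_le\<close>.\<close>

lemma norm_cinner_le: "cmod (cinner x y) \<le> norm x * norm (y :: 'a :: complex_hilbert_space)"
proof (cases "cinner x y = 0")
  case False
  define c where "c = cnj (sgn (cinner x y))"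
  have "cmod c = 1"
    using False by (simp add: c_def norm_sgn)
  have "cinner (c *\<^sub>C x) y = complex_of_real (cmod (cinner x y))"
    using False
    by (simp add: cinner_scaleC_left c_def sgn_eq field_simps complex_norm_square [symmetric] power2_eq_square)
  then have "cmod (cinner x y) = Re (cinner (c *\<^sub>C x) y)"
    by simp
  also have "\<dots> \<le> norm (c *\<^sub>C x) * norm y"
    by (rule Re_cinner_le)
  finally show ?thesis
    by (simp add: norm_scaleC \<open>cmod c = 1\<close>)
qed simp

lemma bounded_linear_cinner_left: "bounded_linear (\<lambda>x :: 'a :: complex_hilbert_space. cinner x y)"
  by (rule bounded_linear_intro [where K = "norm y"])
    (auto simp: cinner_add_left cinner_scaleR_left norm_cinner_le scaleR_conv_of_real)

lemma cinner_eq_right: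
  assumes "\<And>x. cinner x y = cinner x (z :: 'a :: complex_hilbert_space)"
  shows "y = z"
proof -
  have "cinner (y - z) (y - z) = 0"
    by (simp add: cinner_diff_right assms)
  then show ?thesis
    by (simp add: cinner_self)
qed

section \<open>Riesz representation and existence of adjoints\<close>

text \<open>The representing vector is found as a minimiser of the functional \<open>J\<close>
  below. Minimising sequences converge by the parallelogram law and completeness, and the
  first-order condition at the minimum gives the real part of the identity.\<close>

lemma riesz_representation:
  fixes \<phi> :: "'a :: complex_hilbert_space \<Rightarrow> complex"
  assumes bl: "bounded_linear \<phi>" and sc: "\<And>c x. \<phi> (c *\<^sub>C x) = c * \<phi> x"
  shows "\<exists>y. \<forall>x. \<phi> x = cinner x y"
proof -
  interpret bounded_linear \<phi> by (rule bl)
  \<comment> \<open>If \<open>\<phi>\<close> is the pairing with \<open>y\<close>, then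
    \<open>J x\<close> is the squared distance from \<open>x\<close> to \<open>y\<close> minus
    \<open>(norm y)\<^sup>2\<close>, so the vector sought is the only possible minimiser.\<close>
  define J where "J x = (norm x)\<^sup>2 - 2 * Re (\<phi> x)" for x
  obtain C where C: "\<And>x. norm (\<phi> x) \<le> norm x * C"
    using bounded by blast
  have J_ge: "J x \<ge> - C\<^sup>2" for x
  proof -
    have "Re (\<phi> x) \<le> norm x * C"
      using C [of x] complex_Re_le_cmod [of "\<phi> x"] by linarith
    then show ?thesis
      using zero_le_power2 [of "norm x - C"] by (simp add: J_def power2_diff)
  qed
  define m where "m = Inf (range J)"
  have bdd: "bdd_below (range J)"
    using J_ge by (rule bdd_belowI2)
  have m_le: "m \<le> J x" for x
    unfolding m_def by (rule cInf_lower [OF _ bdd]) simp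
  have "\<exists>x. J x < m + 1 / real (Suc n)" for n
  proof -
    have "Inf (range J) < m + 1 / real (Suc n)"
      by (simp add: m_def)
    then show ?thesis
      using cInf_lessD [of "range J"] by blast
  qed
  then obtain X where X: "\<And>n. J (X n) < m + 1 / real (Suc n)"
    by metis
  \<comment> \<open>Parallelogram law, with the value of \<open>J\<close> at the midpoint bounded
    below by \<open>m\<close>.\<close>
  have par: "(norm (x - y))\<^sup>2 \<le> 2 * (J x - m) + 2 * (J y - m)" for x y
  proof -
    have "J ((1/2) *\<^sub>R (x + y)) = (norm (x + y))\<^sup>2 / 4 - Re (\<phi> x) - Re (\<phi> y)"
      by (simp add: J_def scaleR add power_mult_distrib power_divide add_divide_distrib del: scaleR_add_right)
    then have "m \<le> (norm (x + y))\<^sup>2 / 4 - Re (\<phi> x) - Re (\<phi> y)"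
      using m_le by metis
    then show ?thesis
      unfolding J_def norm_add_sq norm_diff_sq by argo
  qed
  have "Cauchy X"
  proof (rule metric_CauchyI)
    fix e :: real assume "e > 0"
    \<comment> \<open>Chosen so that \<open>J\<close> exceeds \<open>m\<close> by less than
      \<open>e\<^sup>2 / 4\<close> along the tail; the right-hand side of \<open>par\<close> is then
      less than \<open>e\<^sup>2\<close>.\<close>
    then obtain N where N: "4 / e\<^sup>2 < real N" 
      using reals_Archimedean2 by blast
    have small: "J (X n) - m < e\<^sup>2 / 4" if "n \<ge> N" for n
    proof -
      have "4 / e\<^sup>2 < real (Suc n)"
        using N that by linarith
      then have "1 / real (Suc n) < e\<^sup>2 / 4"
        using \<open>e > 0\<close> by (simp add: field_simps)
      then show ?thesis
        using X [of n] by linarith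
    qed
    show "\<exists>M. \<forall>i\<ge>M. \<forall>j\<ge>M. dist (X i) (X j) < e"
    proof (intro exI allI impI)
      fix i j assume "N \<le> i" "N \<le> j"
      then have "(norm (X i - X j))\<^sup>2 < e\<^sup>2"
        using par [of "X i" "X j"] small [OF \<open>N \<le> i\<close>] small [OF \<open>N \<le> j\<close>] by argo
      then show "dist (X i) (X j) < e"
        using \<open>e > 0\<close> by (simp add: dist_norm power2_less_imp_less)
    qed
  qed
  then obtain y where y: "X \<longlonglongrightarrow> y"
    using Cauchy_convergent_iff convergent_def by blast
  have "(\<lambda>n. J (X n)) \<longlonglongrightarrow> J y"
    unfolding J_def by (intro tendsto_intros y tendsto)
  moreover have "(\<lambda>n. m + 1 / real (Suc n)) \<longlonglongrightarrow> m + 0"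
    by (intro tendsto_intros LIMSEQ_Suc [OF lim_1_over_n])
  ultimately have "J y \<le> m + 0"
    using X by (intro LIMSEQ_le) (auto intro: less_imp_le)
  then have min: "J y \<le> J x" for x
    using m_le [of x] by linarith
  have Re_eq: "Re (\<phi> x) = Re (cinner x y)" for x
  proof (rule ccontr)
    assume ne: "Re (\<phi> x) \<noteq> Re (cinner x y)"
    define d where "d = Re (\<phi> x) - Re (cinner x y)"
    \<comment> \<open>The added 1 keeps \<open>q\<close> positive when \<open>x = 0\<close>. Moving
      from \<open>y\<close> by \<open>d / q\<close> along \<open>x\<close> would lower
      \<open>J\<close> by at least \<open>d * d / q\<close>.\<close>
    define q where "q = (norm x)\<^sup>2 + 1"
    have "q > 0" "(norm x)\<^sup>2 < q"
      by (auto simp: q_def add_nonneg_pos)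
    have "J (y + s *\<^sub>R x) = J y + s\<^sup>2 * (norm x)\<^sup>2 - 2 * s * d" for s
    proof -
      have "J (y + s *\<^sub>R x)
          = (norm y)\<^sup>2 + 2 * (s * Re (cinner y x)) + s\<^sup>2 * (norm x)\<^sup>2 - 2 * (Re (\<phi> y) + s * Re (\<phi> x))"
        unfolding J_def norm_add_sq by (simp add: add scaleR cinner_scaleR_right power_mult_distrib)
      moreover have "Re (cinner y x) = Re (cinner x y)"
        by (subst cinner_commute) simp
      ultimately show ?thesis
        by (simp add: J_def d_def algebra_simps)
    qed
    from this [of "d/q"] have "2 * (d/q) * d \<le> (d/q)\<^sup>2 * (norm x)\<^sup>2"
      using min [of "y + (d/q) *\<^sub>R x"] by linarith
    also have "\<dots> \<le> (d/q)\<^sup>2 * q"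
      using \<open>(norm x)\<^sup>2 < q\<close> by (intro mult_left_mono) auto
    also have "\<dots> = (d/q) * d"
      using \<open>q > 0\<close> by (simp add: power2_eq_square)
    finally have "d * d / q \<le> 0"
      by simp
    moreover have "d \<noteq> 0"
      using ne by (simp add: d_def)
    then have "d * d / q > 0"
      using \<open>q > 0\<close> by (intro divide_pos_pos) (simp_all flip: power2_eq_square)
    ultimately show False by simp
  qed
  \<comment> \<open>The vector \<open>\<i> *\<^sub>C x\<close> recovers the imaginary part from the
    real one.\<close>
  have "\<phi> x = cinner x y" for x
    using Re_eq [of x] Re_eq [of "\<i> *\<^sub>C x"] by (simp add: sc cinner_scaleC_left complex_eq_iff)
  then show ?thesis by blast
qed

text \<open>Riesz representation of the functional pairing \<open>A x\<close> with \<open>y\<close>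
  defines \<open>b y\<close>. Linearity of \<open>b\<close> follows because the inner product
  separates vectors, and its bound from Cauchy-Schwarz applied to \<open>cinner (A (b x)) x\<close>,
  whose modulus is the square of \<open>norm (b x)\<close>.\<close>

lemma adjoint_exists:
  fixes A :: "'a :: complex_hilbert_space \<Rightarrow>\<^sub>L 'a"
  assumes "A \<in> bounded_ops"
  shows "\<exists>B\<in>bounded_ops. \<forall>x y. cinner (A x) y = cinner x (B y)"
proof -
  have lin: "A (c *\<^sub>C x) = c *\<^sub>C A x" for c x
    using assms by (auto simp: bounded_ops_def)
  have "\<exists>b. \<forall>x. cinner (A x) y = cinner x b" for y
  proof (rule riesz_representation)
    show "bounded_linear (\<lambda>x. cinner (A x) y)"
      by (rule bounded_linear_compose [OF bounded_linear_cinner_left blinfun.bounded_linear_right])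
  qed (simp add: lin cinner_scaleC_left)
  then obtain b where b: "\<And>x y. cinner (A x) y = cinner x (b y)"
    by metis
  have bl: "bounded_linear b"
  proof (rule bounded_linear_intro)
    show "b (x + y) = b x + b y" for x y
      by (rule cinner_eq_right) (simp add: b [symmetric] cinner_add_right)
    show "b (r *\<^sub>R x) = r *\<^sub>R b x" for r x
      by (rule cinner_eq_right) (simp add: b [symmetric] cinner_scaleR_right)
    show "norm (b x) \<le> norm x * norm A" for x
    proof -
      have "(norm (b x))\<^sup>2 = cmod (cinner (A (b x)) x)"
        by (simp add: b cinner_self norm_power)
      also have "\<dots> \<le> norm (A (b x)) * norm x"
        by (rule norm_cinner_le)
      also have "\<dots> \<le> norm A * norm (b x) * norm x"
        by (intro mult_right_mono norm_blinfun) auto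
      finally have "norm (b x) * norm (b x) \<le> norm (b x) * (norm x * norm A)"
        by (simp add: power2_eq_square mult_ac)
      then show ?thesis
        by (cases "b x = 0") auto
    qed
  qed
  define B where "B = Blinfun b"
  have B: "blinfun_apply B = b"
    unfolding B_def by (rule bounded_linear_Blinfun_apply [OF bl])
  have "b (c *\<^sub>C x) = c *\<^sub>C b x" for c x
    by (rule cinner_eq_right) (simp add: b [symmetric] cinner_scaleC_right)
  then show ?thesis
    by (intro bexI [of _ B]) (auto simp: B b bounded_ops_def)
qed

text \<open>The inner product separates vectors, so at most one operator meets the definite
  description in \<open>adjoint_op\<close>.\<close>

lemma adjoint_opI:
  fixes A :: "'a :: complex_hilbert_space \<Rightarrow>\<^sub>L 'a"
  assumes "B \<in> bounded_ops" "\<And>x y. cinner (A x) y = cinner x (B y)"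
  shows "adjoint_op A = B"
  unfolding adjoint_op_def
proof (rule the_equality)
  fix C assume C: "C \<in> bounded_ops \<and> (\<forall>x y. cinner (A x) y = cinner x (C y))"
  show "C = B"
    by (rule blinfun_eqI, rule cinner_eq_right) (use C assms in metis)
qed (use assms in auto)

lemma adjoint_op:
  fixes A :: "'a :: complex_hilbert_space \<Rightarrow>\<^sub>L 'a"
  assumes "A \<in> bounded_ops"
  shows "adjoint_op A \<in> bounded_ops" and "cinner (A x) y = cinner x (adjoint_op A y)"
  using adjoint_exists [OF assms] adjoint_opI by metis+


section \<open>The Herglotz formula and Riemann sums\<close>

text \<open>Uniform continuity on the compact product provides one mesh size that serves all
  \<open>z\<close> in \<open>K\<close> at once.\<close>

lemma uniform_limit_riemann_sum:
  fixes \<phi> :: "real \<Rightarrow> 'b :: metric_space \<Rightarrow> 'c :: euclidean_space"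
  assumes cont: "continuous_on ({0..1} \<times> K) (\<lambda>(t, z). \<phi> t z)" and "compact K"
  shows "uniform_limit K (\<lambda>n z. (1 / real n) *\<^sub>R (\<Sum>j<n. \<phi> (real j / real n) z))
           (\<lambda>z. integral {0..1} (\<lambda>t. \<phi> t z)) sequentially"
proof (rule uniform_limitI)
  fix e :: real assume "e > 0"
  have uc: "uniformly_continuous_on ({0..1} \<times> K) (\<lambda>(t, z). \<phi> t z)"
    by (intro compact_uniformly_continuous cont compact_Times \<open>compact K\<close>) auto
  obtain d where "d > 0" and ud: "\<And>p q. \<lbrakk>p \<in> {0..1} \<times> K; q \<in> {0..1} \<times> K; dist q p < d\<rbrakk>
      \<Longrightarrow> dist (case_prod \<phi> q) (case_prod \<phi> p) < e / 2"
    using uniformly_continuous_onE [OF uc half_gt_zero [OF \<open>e > 0\<close>]] by blast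
  have d: "dist (\<phi> s z) (\<phi> t z) < e / 2"
    if "t \<in> {0..1}" "s \<in> {0..1}" "z \<in> K" "dist s t < d" for t s z
    using ud [of "(t, z)" "(s, z)"] that by (simp add: dist_Pair_Pair)
  obtain N where "1 / d < real N"
    using reals_Archimedean2 by blast
  show "\<forall>\<^sub>F n in sequentially. \<forall>z\<in>K. dist ((1 / real n) *\<^sub>R (\<Sum>j<n. \<phi> (real j / real n) z))
      (integral {0..1} (\<lambda>t. \<phi> t z)) < e"
  \<comment> \<open>Starting at \<open>Suc N\<close> keeps \<open>n\<close> positive besides making
    the mesh smaller than \<open>d\<close>.\<close>
  proof (rule eventually_sequentiallyI [of "Suc N"], intro ballI)
    fix n z assume "Suc N \<le> n" "z \<in> K"
    then have "n > 0" "1 / d < real n"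
      using \<open>1 / d < real N\<close> by auto
    then have n: "n > 0" "1 / real n < d"
      using \<open>d > 0\<close> by (auto simp: field_simps)
    have contz: "continuous_on {0..1} (\<lambda>t. \<phi> t z)"
    proof -
      have "continuous_on {0..1} (\<lambda>t. (t, z))" "(\<lambda>t. (t, z)) ` {0..1} \<subseteq> {0..1} \<times> K"
        using \<open>z \<in> K\<close> by (auto intro!: continuous_intros)
      from continuous_on_compose2 [OF cont this] show ?thesis
        by simp
    qed
    have int: "(\<lambda>t. \<phi> t z) integrable_on {a..b}" if "0 \<le> a" "b \<le> 1" for a b
      by (rule integrable_continuous_real [OF continuous_on_subset [OF contz]]) (use that in auto)
    \<comment> \<open>The induction runs over \<open>m\<close> with the mesh \<open>1 / n\<close>
      fixed; \<open>m = n\<close> gives the whole integral.\<close>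
    have split: "integral {0..real m / real n} (\<lambda>t. \<phi> t z)
        = (\<Sum>j<m. integral {real j / real n..real (Suc j) / real n} (\<lambda>t. \<phi> t z))" if "m \<le> n" for m
      using that
    proof (induction m)
      case (Suc m)
      have "integral {0..real m / real n} (\<lambda>t. \<phi> t z)
          + integral {real m / real n..real (Suc m) / real n} (\<lambda>t. \<phi> t z)
          = integral {0..real (Suc m) / real n} (\<lambda>t. \<phi> t z)"
        using Suc.prems n by (intro Henstock_Kurzweil_Integration.integral_combine int) (auto simp: field_simps)
      then show ?case
        using Suc by simp
    qed simp
    have "(1 / real n) *\<^sub>R (\<Sum>j<n. \<phi> (real j / real n) z) - integral {0..1} (\<lambda>t. \<phi> t z)
        = (\<Sum>j<n. (1 / real n) *\<^sub>R \<phi> (real j / real n) z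
              - integral {real j / real n..real (Suc j) / real n} (\<lambda>t. \<phi> t z))"
      using split [of n] n by (simp add: sum_subtractf scaleR_sum_right)
    also have "norm \<dots> \<le> (\<Sum>j<n. e / 2 * (1 / real n))"
    proof (rule sum_norm_le)
      fix j assume "j \<in> {..<n}"
      let ?a = "real j / real n" and ?b = "real (Suc j) / real n"
      have ab: "0 \<le> ?a" "?a \<le> ?b" "?b \<le> 1" "?b - ?a = 1 / real n"
        using \<open>j \<in> {..<n}\<close> by (auto simp: field_simps)
      \<comment> \<open>The error on one cell is the integral of the deviation from the left
        endpoint value, hence at most \<open>e / 2\<close> times the length of the cell. The
        \<open>n\<close> cells together contribute at most \<open>e / 2\<close>.\<close>
      have i: "((\<lambda>t. \<phi> ?a z - \<phi> t z) has_integral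
          (?b - ?a) *\<^sub>R \<phi> ?a z - integral {?a..?b} (\<lambda>t. \<phi> t z)) {?a..?b}"
        using has_integral_diff [OF has_integral_const_real integrable_integral [OF int]] ab
        by (metis measure_lborel_Icc)
      have "norm ((?b - ?a) *\<^sub>R \<phi> ?a z - integral {?a..?b} (\<lambda>t. \<phi> t z))
          \<le> e / 2 * measure lborel {?a..?b}"
      proof (rule has_integral_bound_real [where S = "{}", OF _ _ i])
        fix t assume "t \<in> {?a..?b} - {}"
        then have t: "t \<in> {?a..?b}" by simp
        have "0 \<le> t" "t \<le> 1" "?a \<le> 1" "\<bar>?a - t\<bar> < d"
        proof -
          show "0 \<le> t" "t \<le> 1" "?a \<le> 1"
            using order_trans [OF ab(1)] order_trans [OF _ ab(3)] order_trans [OF ab(2,3)] t by auto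
          show "\<bar>?a - t\<bar> < d"
            using t ab(4) n unfolding atLeastAtMost_iff by linarith
        qed
        then have "dist (\<phi> ?a z) (\<phi> t z) < e / 2"
          using ab \<open>z \<in> K\<close> by (intro d) (auto simp: dist_real_def)
        then show "norm (\<phi> ?a z - \<phi> t z) \<le> e / 2"
          by (simp add: dist_norm)
      qed (use \<open>e > 0\<close> in auto)
      then show "norm ((1 / real n) *\<^sub>R \<phi> ?a z - integral {?a..?b} (\<lambda>t. \<phi> t z)) \<le> e / 2 * (1 / real n)"
        using ab by (metis measure_lborel_Icc)
    qed
    also have "\<dots> < e"
      using n \<open>e > 0\<close> by simp
    finally show "dist ((1 / real n) *\<^sub>R (\<Sum>j<n. \<phi> (real j / real n) z))
        (integral {0..1} (\<lambda>t. \<phi> t z)) < e"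
      by (simp add: dist_norm)
  qed
qed

section \<open>The Herglotz kernel and its integrals over the circle\<close>

definition herglotz_kernel :: "complex \<Rightarrow> complex \<Rightarrow> complex" where
  "herglotz_kernel \<zeta> z = (\<zeta> + z) / (\<zeta> - z)"

text \<open>The right-hand side is the Poisson kernel: positive for \<open>z\<close> in the disc,
  zero for \<open>z\<close> on the circle. At \<open>z = \<zeta>\<close> both sides are 0 because
  division by zero gives 0.\<close>

lemma Re_herglotz_kernel:
  assumes "cmod \<zeta> = 1"
  shows "Re (herglotz_kernel \<zeta> z) = (1 - (cmod z)\<^sup>2) / (cmod (\<zeta> - z))\<^sup>2"
proof -
  have "Re (herglotz_kernel \<zeta> z) = ((cmod \<zeta>)\<^sup>2 - (cmod z)\<^sup>2) / (cmod (\<zeta> - z))\<^sup>2"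
    unfolding herglotz_kernel_def Re_divide cmod_power2 
    by (simp add: power2_eq_square algebra_simps)
  then show ?thesis
    using assms by simp
qed

text \<open>Along the circle the differential of \<zeta> is 2 pi i \<zeta> dt, so the denominator
  \<zeta> cancels and the average over the circle remains.\<close>

lemma integral_cis_circlepath:
  assumes "((\<lambda>\<zeta>. u \<zeta> / \<zeta>) has_contour_integral 2 * pi * \<i> * L) (circlepath 0 1)"
  shows "((\<lambda>t. u (cis (2 * pi * t))) has_integral L) {0..1}"
proof -
  have cis: "cis (2 * pi * t) = exp (2 * pi * \<i> * t)" for t
    by (simp add: cis_conv_exp mult_ac)
  have "((\<lambda>t. u (cis (2 * pi * t)) / cis (2 * pi * t) * (2 * pi * \<i> * cis (2 * pi * t)))
      has_integral 2 * pi * \<i> * L) {0..1}"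
    using assms unfolding has_contour_integral_def
    by (rule has_integral_eq [rotated]) (simp add: vector_derivative_circlepath01, simp add: circlepath cis)
  then have "((\<lambda>t. 2 * pi * \<i> * u (cis (2 * pi * t))) has_integral 2 * pi * \<i> * L) {0..1}"
    by (simp add: mult_ac)
  from has_integral_mult_right [OF this, of "1 / (2 * pi * \<i>)"] show ?thesis
    by simp
qed

text \<open>Partial fractions give \<open>herglotz_kernel u z / u = 2 / (u - z) - 1 / u\<close>;
  Cauchy's formula at \<open>z\<close> and at \<open>0\<close> does the rest.\<close>

lemma integral_herglotz_kernel:
  assumes g: "g holomorphic_on cball 0 1" and z: "cmod z < 1"
  shows "((\<lambda>t. herglotz_kernel (cis (2 * pi * t)) z * g (cis (2 * pi * t)))
           has_integral 2 * g z - g 0) {0..1}"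
proof (rule integral_cis_circlepath [where u = "\<lambda>\<zeta>. herglotz_kernel \<zeta> z * g \<zeta>"])
  have c: "((\<lambda>u. g u / (u - w)) has_contour_integral 2 * pi * \<i> * g w) (circlepath 0 1)"
    if "cmod w < 1" for w
    using Cauchy_integral_circlepath_simple [OF g, of w] that by simp
  have "((\<lambda>u. 2 * (g u / (u - z)) - g u / (u - 0)) has_contour_integral
      2 * (2 * pi * \<i> * g z) - 2 * pi * \<i> * g 0) (circlepath 0 1)"
    by (intro has_contour_integral_diff has_contour_integral_lmul c z) auto
  moreover have "2 * (g u / (u - z)) - g u / (u - 0) = herglotz_kernel u z * g u / u"
    if "u \<in> path_image (circlepath 0 1)" for u
  proof -
    have "cmod u = 1"
      using that by simp
    then have "u \<noteq> 0" "u \<noteq> z"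
      using z by auto
    then show ?thesis
      by (simp add: herglotz_kernel_def divide_simps) (simp add: algebra_simps)
  qed
  ultimately show "((\<lambda>u. herglotz_kernel u z * g u / u) has_contour_integral
      2 * pi * \<i> * (2 * g z - g 0)) (circlepath 0 1)"
    by (auto intro: has_contour_integral_eq simp: algebra_simps)
qed

text \<open>On the circle, the conjugated kernel extends holomorphically to the closed disc, so that the
  mean value property applies.\<close>

lemma integral_herglotz_kernel_cnj:
  assumes g: "g holomorphic_on cball 0 1" and z: "cmod z < 1"
  shows "((\<lambda>t. herglotz_kernel (cis (2 * pi * t)) z * cnj (g (cis (2 * pi * t))))
           has_integral cnj (g 0)) {0..1}"
proof -
  define u where "u \<zeta> = (1 + cnj z * \<zeta>) / (1 - cnj z * \<zeta>) * g \<zeta>" for \<zeta>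
  have ne: "1 - cnj z * w \<noteq> 0" if "cmod w \<le> 1" for w
  proof
    assume "1 - cnj z * w = 0"
    then have "cmod (cnj z * w) = 1"
      by (metis eq_iff_diff_eq_0 norm_one)
    moreover have "cmod (cnj z * w) \<le> cmod z * 1"
      using that by (simp add: norm_mult mult_left_le)
    ultimately show False
      using z by simp
  qed
  have "u holomorphic_on cball 0 1"
    unfolding u_def by (intro holomorphic_intros g) (use ne in auto)
  \<comment> \<open>Cauchy's formula at the centre, where the factor of \<open>g\<close> in
    \<open>u\<close> is 1 and hence \<open>u 0 = g 0\<close>.\<close>
  then have "((\<lambda>\<zeta>. u \<zeta> / (\<zeta> - 0)) has_contour_integral 2 * pi * \<i> * u 0) (circlepath 0 1)"
    using Cauchy_integral_circlepath_simple [of u 0 1 0] by simp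
  then have "((\<lambda>t. u (cis (2 * pi * t))) has_integral u 0) {0..1}"
    by (intro integral_cis_circlepath) simp
  then have "((\<lambda>t. cnj (u (cis (2 * pi * t)))) has_integral cnj (u 0)) {0..1}"
    using has_integral_cnj [of "\<lambda>t. u (cis (2 * pi * t))"] by (simp add: o_def)
  moreover have "cnj (u \<zeta>) = herglotz_kernel \<zeta> z * cnj (g \<zeta>)" if "cmod \<zeta> = 1" for \<zeta>
  proof -
    have 1: "\<zeta> * cnj \<zeta> = 1" "\<zeta> \<noteq> 0"
      using that by (auto simp: complex_norm_square [symmetric])
    \<comment> \<open>On the circle \<open>cnj \<zeta>\<close> is the inverse of
      \<open>\<zeta>\<close>, so expanding the fraction by \<open>\<zeta>\<close> yields the
      kernel.\<close>
    have "\<zeta> * (1 + z * cnj \<zeta>) = \<zeta> + z" "\<zeta> * (1 - z * cnj \<zeta>) = \<zeta> - z"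
      using 1(1) by (simp_all add: distrib_left right_diff_distrib mult.left_commute [of \<zeta> z])
    then have "(1 + z * cnj \<zeta>) / (1 - z * cnj \<zeta>) = (\<zeta> + z) / (\<zeta> - z)"
      using 1(2) by (metis mult_divide_mult_cancel_left)
    then show ?thesis
      by (simp add: u_def herglotz_kernel_def flip: times_divide_eq_left)
  qed
  ultimately show ?thesis
    by (simp add: u_def)
qed

text \<open>Half the sum of the two integral formulas is
  \<open>g z - (g 0 - cnj (g' 0)) / 2\<close>, and the constant in front restores
  \<open>g z\<close>. Two functions occur because a matrix coefficient of the real part of
  \<open>A\<close> at \<open>h\<close>, \<open>k\<close> combines \<open>cinner (A h) k\<close> with
  the conjugate of \<open>cinner (A k) h\<close>.\<close>

lemma uniform_limit_herglotz_sum: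
  assumes g: "g holomorphic_on cball 0 1" and g': "g' holomorphic_on cball 0 1"
    and K: "compact K" "K \<subseteq> unit_disc"
  shows "uniform_limit K
      (\<lambda>n z. (g 0 - cnj (g' 0)) / 2 + (\<Sum>j<n. herglotz_kernel (cis (2 * pi * (real j / real n))) z / n
          * ((g (cis (2 * pi * (real j / real n))) + cnj (g' (cis (2 * pi * (real j / real n))))) / 2)))
      g sequentially"
proof -
  define \<phi> where "\<phi> t z = herglotz_kernel (cis (2 * pi * t)) z
      * ((g (cis (2 * pi * t)) + cnj (g' (cis (2 * pi * t)))) / 2)" for t z
  have cg: "continuous_on ({0..1} \<times> K) (\<lambda>p. h (cis (2 * pi * fst p)))" if "h holomorphic_on cball 0 1" for h
    by (rule continuous_on_compose2 [OF holomorphic_on_imp_continuous_on [OF that]])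
      (auto intro!: continuous_intros)
  have "continuous_on ({0..1} \<times> K) (\<lambda>p. \<phi> (fst p) (snd p))"
    unfolding \<phi>_def herglotz_kernel_def using K
    by (intro continuous_intros cg g g') (auto dest: subsetD)
  then have "continuous_on ({0..1} \<times> K) (\<lambda>(t, z). \<phi> t z)"
    by (simp add: case_prod_unfold)
  from uniform_limit_riemann_sum [OF this K(1)]
  have "uniform_limit K (\<lambda>n z. (g 0 - cnj (g' 0)) / 2 + (1 / real n) *\<^sub>R (\<Sum>j<n. \<phi> (real j / real n) z))
      (\<lambda>z. (g 0 - cnj (g' 0)) / 2 + integral {0..1} (\<lambda>t. \<phi> t z)) sequentially"
    by (intro uniform_limit_intros)
  moreover have "(g 0 - cnj (g' 0)) / 2 + integral {0..1} (\<lambda>t. \<phi> t z) = g z" if "z \<in> K" for z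
  proof -
    have z: "cmod z < 1"
      using that K by auto
    have "((\<lambda>t. (herglotz_kernel (cis (2 * pi * t)) z * g (cis (2 * pi * t)) +
        herglotz_kernel (cis (2 * pi * t)) z * cnj (g' (cis (2 * pi * t)))) / 2) has_integral
        (2 * g z - g 0 + cnj (g' 0)) / 2) {0..1}"
      by (intro has_integral_divide has_integral_add integral_herglotz_kernel
          integral_herglotz_kernel_cnj g g' z)
    then have "((\<lambda>t. \<phi> t z) has_integral (2 * g z - g 0 + cnj (g' 0)) / 2) {0..1}"
      by (simp add: \<phi>_def algebra_simps add_divide_distrib)
    then show ?thesis
      by (simp add: integral_unique field_simps)
  qed
  ultimately show ?thesis
    by (subst (asm) uniform_limit_cong' [where g = "\<lambda>n z. (g 0 - cnj (g' 0)) / 2 + (\<Sum>j<n. herglotz_kernel (cis (2 * pi * (real j / real n))) z / n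
          * ((g (cis (2 * pi * (real j / real n))) + cnj (g' (cis (2 * pi * (real j / real n))))) / 2))" and i = g])
      (simp_all add: \<phi>_def sum_distrib_left scaleR_conv_of_real)
qed

section \<open>Null sets of arc length\<close>

text \<open>Since \<open>cis\<close> is injective on the half-open interval, finitely many points of
  the circle have finitely many parameters, a Lebesgue null set. The set \<open>Z\<close> will
  consist of the poles of an approximant.\<close>

lemma AE_arc_length:
  assumes "finite Z"
  shows "AE \<zeta> in arc_length. cmod \<zeta> = 1 \<and> \<zeta> \<notin> Z"
proof -
  have cis: "cis \<in> restrict_space lborel {0..<2 * pi} \<rightarrow>\<^sub>M borel"
    by (intro measurable_restrict_space1) (simp add: borel_measurable_continuous_onI continuous_intros)
  have "inj_on cis {0..<2 * pi}"
  proof (rule inj_onI)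
    fix x y assume "x \<in> {0..<2 * pi}" "y \<in> {0..<2 * pi}" "cis x = cis y"
    then show "x = y"
      using exp_complex_eqI [of "\<i> * x" "\<i> * y"] by (auto simp: cis_conv_exp)
  qed
  then have "countable (cis -` Z \<inter> {0..<2 * pi})"
    by (intro countable_finite finite_vimage_IntI assms)
  then have "AE t in lborel. t \<notin> cis -` Z \<inter> {0..<2 * pi}"
    by (intro AE_not_in countable_imp_null_set_lborel)
  then have "AE t in restrict_space lborel {0..<2 * pi}. cmod (cis t) = 1 \<and> cis t \<notin> Z"
    by (subst AE_restrict_space_iff) (auto elim: eventually_mono)
  moreover have "{\<zeta> \<in> space borel. cmod \<zeta> = 1 \<and> \<zeta> \<notin> Z} = sphere 0 1 - Z"
    by auto
  then have "{\<zeta> \<in> space borel. cmod \<zeta> = 1 \<and> \<zeta> \<notin> Z} \<in> sets borel"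
    using assms by (simp add: finite_imp_closed borel_closed sets.Diff)
  ultimately show ?thesis
    unfolding arc_length_def by (subst AE_distr_iff [OF cis])
qed


section \<open>Operator-valued functions\<close>

lemma bounded_ops_add: "A \<in> bounded_ops \<Longrightarrow> B \<in> bounded_ops \<Longrightarrow> A + B \<in> bounded_ops"
  by (auto simp: bounded_ops_def plus_blinfun.rep_eq scaleC_add_right)

lemma bounded_ops_scaleC: "A \<in> bounded_ops \<Longrightarrow> scaleC_op c A \<in> bounded_ops"
  by (auto simp: bounded_ops_def scaleC_op.rep_eq scaleC_scaleC mult.commute)

lemma scaleR_eq_scaleC_op: "r *\<^sub>R A = scaleC_op (complex_of_real r) A"
  by (rule blinfun_eqI) (simp add: scaleC_op.rep_eq scaleR_blinfun.rep_eq scaleR_scaleC)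

lemma bounded_ops_scaleR: "A \<in> bounded_ops \<Longrightarrow> r *\<^sub>R A \<in> bounded_ops"
  by (simp add: scaleR_eq_scaleC_op bounded_ops_scaleC)

lemma bounded_ops_diff: "A \<in> bounded_ops \<Longrightarrow> B \<in> bounded_ops \<Longrightarrow> A - B \<in> bounded_ops"
  using bounded_ops_add [of A "- 1 *\<^sub>R B"] bounded_ops_scaleR [of B "- 1"] by simp

lemma bounded_ops_sum:
  "(\<And>j. j \<in> J \<Longrightarrow> A j \<in> bounded_ops) \<Longrightarrow> (\<Sum>j\<in>J. A j) \<in> bounded_ops"
proof (induction J rule: infinite_finite_induct)
  case (insert x F)
  then show ?case by (simp add: bounded_ops_add)
\<comment> \<open>For the zero operator the claim is \<open>c *\<^sub>C 0 = 0\<close>, read off from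
  norms.\<close>
qed (auto simp: bounded_ops_def scaleC_op.rep_eq norm_scaleC simp flip: norm_eq_zero)

lemma bounded_linear_scaleC_op: "bounded_linear (\<lambda>c. scaleC_op c A)"
proof (rule bounded_linear_intro [where K = "norm A"])
  show "scaleC_op (c + d) A = scaleC_op c A + scaleC_op d A" for c d
    by (rule blinfun_eqI) (simp add: scaleC_op.rep_eq plus_blinfun.rep_eq scaleC_add_left)
  show "scaleC_op (r *\<^sub>R c) A = r *\<^sub>R scaleC_op c A" for r c
    by (rule blinfun_eqI)
      (simp add: scaleC_op.rep_eq scaleR_blinfun.rep_eq scaleR_scaleC scaleC_scaleC scaleR_conv_of_real)
  show "norm (scaleC_op c A) \<le> norm c * norm A" for c
  proof (rule norm_blinfun_bound)
    show "norm (scaleC_op c A x) \<le> cmod c * norm A * norm x" for x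
      using mult_left_mono [OF norm_blinfun [of A x], of "cmod c"]
      by (simp add: scaleC_op.rep_eq norm_scaleC mult.assoc)
  qed simp
qed

lemma scaleC_op_sum_right: "scaleC_op c (\<Sum>j\<in>J. A j) = (\<Sum>j\<in>J. scaleC_op c (A j))"
  by (rule blinfun_eqI)
    (simp add: scaleC_op.rep_eq blinfun.sum_left linear_sum [OF bounded_linear.linear [OF bounded_linear_scaleC]])

lemma scaleC_op_scaleC_op: "scaleC_op c (scaleC_op d A) = scaleC_op (c * d) A"
  by (rule blinfun_eqI) (simp add: scaleC_op.rep_eq scaleC_scaleC)

text \<open>Taking a matrix coefficient is bounded and linear, so it carries the operator-norm limit
  of difference quotients to a scalar one.\<close>

lemma holomorphic_op_on_imp_holomorphic_on:
  assumes "holomorphic_op_on f S"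
  shows "(\<lambda>z. cinner (f z h) k) holomorphic_on S"
  unfolding holomorphic_on_def
proof
  fix z assume "z \<in> S"
  then obtain A where A: "((\<lambda>w. scaleC_op (1 / (w - z)) (f w - f z)) \<longlongrightarrow> A) (at z within S)"
    using assms by (auto simp: holomorphic_op_on_def)
  have "bounded_linear (\<lambda>B. cinner (blinfun_apply B h) k)"
    by (rule bounded_linear_compose [OF bounded_linear_cinner_left blinfun.bounded_linear_left])
  from bounded_linear.tendsto [OF this A]
  have "((\<lambda>w. (cinner (f w h) k - cinner (f z h) k) / (w - z)) \<longlongrightarrow> cinner (A h) k) (at z within S)"
    by (simp add: scaleC_op.rep_eq minus_blinfun.rep_eq cinner_scaleC_left cinner_diff_left)
  then show "(\<lambda>z. cinner (f z h) k) field_differentiable at z within S"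
    by (auto simp: field_differentiable_def has_field_derivative_iff)
qed

text \<open>This removes the adjoint: later computations with real parts need only matrix
  coefficients of the operator itself.\<close>

lemma cinner_Re_op:
  assumes "A \<in> bounded_ops"
  shows "cinner (Re_op A h) k = (cinner (A h) k + cnj (cinner (A k) h)) / 2"
  using adjoint_op(2) [OF assms, of k h] cinner_commute [of "adjoint_op A h" k]
  by (simp add: Re_op_def scaleR_blinfun.rep_eq plus_blinfun.rep_eq cinner_add_left cinner_scaleR_left
      scaleR_add_right add_divide_distrib)

lemma Re_op_in_bounded_ops: "A \<in> bounded_ops \<Longrightarrow> Re_op A \<in> bounded_ops"
  by (simp add: Re_op_def bounded_ops_add bounded_ops_scaleR adjoint_op)

section \<open>Finite combinations of operators with scalar function coefficients\<close>

text \<open>The common shape of the approximants. All dependence on \<open>z\<close> sits in the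
  scalars \<open>c j\<close>, so holomorphy, real parts and boundary values reduce to scalar
  statements.\<close>

definition op_comb ::
    "('a :: complex_hilbert_space \<Rightarrow>\<^sub>L 'a) \<Rightarrow> 'j set \<Rightarrow> ('j \<Rightarrow> 'a \<Rightarrow>\<^sub>L 'a) \<Rightarrow> ('j \<Rightarrow> complex \<Rightarrow> complex) \<Rightarrow>
      complex \<Rightarrow> 'a \<Rightarrow>\<^sub>L 'a"
  where "op_comb K J A c z = K + (\<Sum>j\<in>J. scaleC_op (c j z) (A j))"

lemma op_comb_bounded:
  assumes "K \<in> bounded_ops" "\<And>j. j \<in> J \<Longrightarrow> A j \<in> bounded_ops"
  shows "op_comb K J A c z \<in> bounded_ops"
  unfolding op_comb_def by (intro bounded_ops_add bounded_ops_sum bounded_ops_scaleC assms)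

lemma cinner_op_comb:
  "cinner (op_comb K J A c z h) k = cinner (K h) k + (\<Sum>j\<in>J. c j z * cinner (A j h) k)"
  by (simp add: op_comb_def plus_blinfun.rep_eq blinfun.sum_left scaleC_op.rep_eq cinner_add_left
      cinner_sum_left cinner_scaleC_left)

text \<open>The skew-adjoint \<open>K\<close> contributes nothing to the real part, and a
  self-adjoint \<open>A j\<close> keeps only the real part of its coefficient.\<close>

lemma cinner_Re_op_comb:
  assumes K: "K \<in> bounded_ops" "\<And>h k. cinner (K h) k = - cnj (cinner (K k) h)"
    and A: "\<And>j. j \<in> J \<Longrightarrow> A j \<in> bounded_ops"
    and A_selfadj: "\<And>j h k. j \<in> J \<Longrightarrow> cinner (A j h) k = cnj (cinner (A j k) h)"
  shows "cinner (Re_op (op_comb K J A c z) h) k = (\<Sum>j\<in>J. complex_of_real (Re (c j z)) * cinner (A j h) k)"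
proof -
  have "cinner (Re_op (op_comb K J A c z) h) k
      = ((\<Sum>j\<in>J. c j z * cinner (A j h) k) + (\<Sum>j\<in>J. cnj (c j z) * cnj (cinner (A j k) h))) / 2"
    using K(2) [of h k] by (simp add: cinner_Re_op [OF op_comb_bounded [OF K(1) A]] cinner_op_comb)
  also have "\<dots> = (\<Sum>j\<in>J. (c j z + cnj (c j z)) / 2 * cinner (A j h) k)"
    by (simp add: sum.distrib [symmetric] sum_divide_distrib A_selfadj [symmetric] algebra_simps add_divide_distrib
        cong: sum.cong)
  also have "\<dots> = (\<Sum>j\<in>J. complex_of_real (Re (c j z)) * cinner (A j h) k)"
    by (simp add: complex_add_cnj)
  finally show ?thesis .
qed

text \<open>In the difference quotient \<open>K\<close> cancels, leaving the fixed operators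
  weighted by scalar difference quotients; these converge in operator norm because
  \<open>scaleC_op\<close> is bounded linear in the scalar.\<close>

lemma holomorphic_op_comb:
  assumes K: "K \<in> bounded_ops" and A: "\<And>j. j \<in> J \<Longrightarrow> A j \<in> bounded_ops"
    and c: "\<And>j. j \<in> J \<Longrightarrow> c j holomorphic_on S"
  shows "holomorphic_op_on (op_comb K J A c) S"
  unfolding holomorphic_op_on_def
proof (intro conjI ballI)
  fix z assume "z \<in> S"
  show "op_comb K J A c z \<in> bounded_ops"
    by (rule op_comb_bounded [OF K A])
  have "\<exists>d. (c j has_field_derivative d) (at z within S)" if "j \<in> J" for j
    using c [OF that] \<open>z \<in> S\<close> unfolding holomorphic_on_def field_differentiable_def by blast
  then obtain D where D: "\<And>j. j \<in> J \<Longrightarrow> (c j has_field_derivative D j) (at z within S)"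
    by metis
  have eq: "scaleC_op (1 / (w - z)) (op_comb K J A c w - op_comb K J A c z)
      = (\<Sum>j\<in>J. scaleC_op ((c j w - c j z) / (w - z)) (A j))" for w
  proof -
    have "op_comb K J A c w - op_comb K J A c z = (\<Sum>j\<in>J. scaleC_op (c j w - c j z) (A j))"
      by (simp add: op_comb_def sum_subtractf
          linear_diff [OF bounded_linear.linear [OF bounded_linear_scaleC_op]])
    then show ?thesis
      by (simp add: scaleC_op_sum_right scaleC_op_scaleC_op)
  qed
  have "((\<lambda>w. \<Sum>j\<in>J. scaleC_op ((c j w - c j z) / (w - z)) (A j))
      \<longlongrightarrow> (\<Sum>j\<in>J. scaleC_op (D j) (A j))) (at z within S)"
    using D by (intro tendsto_sum bounded_linear.tendsto [OF bounded_linear_scaleC_op])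
      (auto simp: has_field_derivative_iff)
  then show "\<exists>B\<in>bounded_ops.
      ((\<lambda>w. scaleC_op (1 / (w - z)) (op_comb K J A c w - op_comb K J A c z)) \<longlongrightarrow> B) (at z within S)"
    unfolding eq by (intro bexI) (auto intro: bounded_ops_sum bounded_ops_scaleC A)
qed

text \<open>Every matrix coefficient is a finite combination of the \<open>c j\<close>, so
  continuity of these at \<open>\<zeta>\<close> suffices for the radial limit.\<close>

lemma boundary_value_op_comb:
  assumes K: "K \<in> bounded_ops" and A: "\<And>j. j \<in> J \<Longrightarrow> A j \<in> bounded_ops"
    and c: "\<And>j. j \<in> J \<Longrightarrow> isCont (c j) \<zeta>"
  shows "boundary_value (op_comb K J A c) \<zeta> (op_comb K J A c \<zeta>)"
proof -
  have r: "((\<lambda>r. complex_of_real r * \<zeta>) \<longlongrightarrow> \<zeta>) (at_left 1)"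
    by (rule tendsto_eq_intros refl | simp)+
  have "((\<lambda>r. cinner (op_comb K J A c (complex_of_real r * \<zeta>) h) k)
      \<longlongrightarrow> cinner (op_comb K J A c \<zeta> h) k) (at_left 1)" for h k
    unfolding cinner_op_comb by (intro tendsto_intros isCont_tendsto_compose [OF c r])
  then show ?thesis
    by (simp add: boundary_value_def wot_tendsto_def op_comb_bounded [OF K A])
qed


section \<open>Approximation\<close>

lemma eventually_ball_ball_finite:
  assumes "finite S" "\<And>h k. eventually (P h k) G"
  shows "\<forall>\<^sub>F x in G. \<forall>h\<in>S. \<forall>k\<in>S. P h k x"
  using assms by (simp add: eventually_ball_finite)

theorem theorem2p2:
  fixes f :: "complex \<Rightarrow> 'a :: complex_hilbert_space \<Rightarrow>\<^sub>L 'a"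
  assumes "holomorphic_op_on f unit_disc"
    and "\<forall>z\<in>unit_disc. positive_op (Re_op (f z))"
  shows "\<exists>(I :: ('a set \<times> nat) set) le F.
           directed_set I le \<and>
           (\<forall>i\<in>I. F i \<in> herglotz_class) \<and>
           (\<forall>i\<in>I. AE \<zeta> in arc_length. \<exists>A. boundary_value (F i) \<zeta> A \<and> Re_op A = 0) \<and>
           wot_compactly_convergent F f (net_filter I le)"
proof -
  have "nonneg_op A" if "positive_op A" for A :: "'a \<Rightarrow>\<^sub>L 'a"
    unfolding nonneg_op_def
  proof
    fix h :: 'a
    \<comment> \<open>The vector \<open>h = 0\<close>, about which \<open>positive_op\<close> is
      silent, makes the form vanish.\<close>
    show "cinner (A h) h \<in> \<real> \<and> 0 \<le> Re (cinner (A h) h)"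
      using that by (cases "h = 0") (auto simp: positive_op_def cinner_zero_right less_imp_le)
  qed
  then have f: "f \<in> herglotz_class"
    using assms by (simp add: herglotz_class_def)

  \<comment> \<open>Approximation of finitely many matrix coefficients on a smaller disc\<close>
  have approx: "\<exists>F\<in>herglotz_class. (AE \<zeta> in arc_length. \<exists>A. boundary_value F \<zeta> A \<and> Re_op A = 0) \<and>
           (\<forall>h\<in>S. \<forall>k\<in>S. \<forall>z\<in>cball 0 \<rho>. cmod (cinner (F z h) k - cinner (f z h) k) < e)"
    if "finite S" "\<rho> < 1" "e > 0" for S :: "'a set" and \<rho> e :: real
  proof -
    define g where "g h k z = cinner (f z h) k" for h k z
    have f_ops: "f z \<in> bounded_ops" if "cmod z < 1" for z
      using f that by (auto simp: herglotz_class_def holomorphic_op_on_def)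
    have hol: "g h k holomorphic_on unit_disc" for h k
      unfolding g_def using f by (auto simp: herglotz_class_def intro: holomorphic_op_on_imp_holomorphic_on)
    have sub: "cball 0 \<rho> \<subseteq> unit_disc"
      using \<open>\<rho> < 1\<close> by auto
    \<comment> \<open>For \<open>z\<close> in the unit disc the dilation moves \<open>z\<close> by
      at most \<open>1 - r\<close>, so uniform continuity on the smaller closed disc applies as soon
      as \<open>1 - r < d\<close>.\<close>
    have dil: "uniform_limit (cball 0 \<rho>) (\<lambda>r z. g h k (complex_of_real r * z)) (g h k) (at_left 1)" for h k
    proof (rule uniform_limitI)
      fix \<epsilon> :: real assume "\<epsilon> > 0"
      have "uniformly_continuous_on (cball 0 \<rho>) (g h k)"
        by (rule compact_uniformly_continuous
            [OF continuous_on_subset [OF holomorphic_on_imp_continuous_on [OF hol] sub] compact_cball])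
      then obtain d where "d > 0" and d: "\<And>w z. \<lbrakk>w \<in> cball 0 \<rho>; z \<in> cball 0 \<rho>; dist w z < d\<rbrakk>
          \<Longrightarrow> dist (g h k w) (g h k z) < \<epsilon>"
        using \<open>\<epsilon> > 0\<close> by (elim uniformly_continuous_onE) blast+
      have "\<forall>\<^sub>F r in at_left 1. max 0 (1 - d) < r \<and> r < (1 :: real)"
        using \<open>d > 0\<close> by (intro eventually_at_leftI [of "max 0 (1 - d)"]) auto
      then show "\<forall>\<^sub>F r in at_left 1. \<forall>z\<in>cball 0 \<rho>. dist (g h k (complex_of_real r * z)) (g h k z) < \<epsilon>"
      proof (rule eventually_mono, intro ballI)
        fix r :: real and z :: complex assume r: "max 0 (1 - d) < r \<and> r < 1" and z: "z \<in> cball 0 \<rho>"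
        have "cmod (complex_of_real r * z) \<le> cmod z"
          using r by (simp add: norm_mult mult_left_le_one_le)
        moreover have "dist (complex_of_real r * z) z < d"
        proof -
          have "dist (complex_of_real r * z) z = (1 - r) * cmod z"
          proof -
            have "complex_of_real r * z - z = complex_of_real (r - 1) * z"
              by (simp add: algebra_simps)
            then show ?thesis
              using r by (simp add: dist_norm norm_mult del: of_real_diff)
          qed
          moreover have "(1 - r) * cmod z \<le> 1 - r"
            using r z \<open>\<rho> < 1\<close> by (intro mult_left_le) auto
          ultimately show ?thesis
            using r by linarith
        qed
        ultimately show "dist (g h k (complex_of_real r * z)) (g h k z) < \<epsilon>"
          using r z by (intro d) auto
      qed
    qed
    have "\<forall>\<^sub>F r in at_left 1. \<forall>h\<in>S. \<forall>k\<in>S. \<forall>z\<in>cball 0 \<rho>. dist (g h k (complex_of_real r * z)) (g h k z) < e / 2"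
      using \<open>e > 0\<close> by (intro eventually_ball_ball_finite \<open>finite S\<close> uniform_limitD [OF dil]) simp
    moreover have "\<forall>\<^sub>F r in at_left 1. 0 < r \<and> r < (1 :: real)"
      by (intro eventually_at_leftI [of 0]) auto
    ultimately have "\<forall>\<^sub>F r in at_left 1. (0 < r \<and> r < (1 :: real)) \<and> (\<forall>h\<in>S. \<forall>k\<in>S. \<forall>z\<in>cball 0 \<rho>.
        dist (g h k (complex_of_real r * z)) (g h k z) < e / 2)"
      by (simp add: eventually_conj_iff)
    then obtain r :: real where r: "0 < r" "r < 1" and r_close: "\<And>h k z. \<lbrakk>h \<in> S; k \<in> S; z \<in> cball 0 \<rho>\<rbrakk>
        \<Longrightarrow> dist (g h k (complex_of_real r * z)) (g h k z) < e / 2"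
      using eventually_happens' [OF trivial_limit_at_left_real] by blast
    \<comment> \<open>The dilated coefficients are holomorphic on the closed unit disc, as the
      integral formulas require.\<close>
    define G where "G h k z = g h k (complex_of_real r * z)" for h k z
    have r_disc: "cmod (complex_of_real r * z) < 1" if "cmod z \<le> 1" for z
      using le_less_trans [OF mult_left_le [OF that] r(2)] r(1) by (simp add: norm_mult)
    have holG: "G h k holomorphic_on cball 0 1" for h k
      unfolding G_def using r_disc
      by (intro holomorphic_on_compose_gen [OF _ hol, unfolded o_def] holomorphic_intros) auto
    define \<zeta> where "\<zeta> n j = cis (2 * pi * (real j / real n))" for n j :: nat
    \<comment> \<open>The skew-adjoint part of \<open>f 0\<close>; its coefficients, computed in
      \<open>cinner_K\<close>, are the constant term in
      \<open>uniform_limit_herglotz_sum\<close>.\<close>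
    define K where "K = f 0 - Re_op (f 0)"
    define A where "A n j = Re_op (f (complex_of_real r * \<zeta> n j))" for n j
    define c where "c n j z = herglotz_kernel (\<zeta> n j) z / n" for n j z
    have [simp]: "cmod (\<zeta> n j) = 1" for n j
      by (simp add: \<zeta>_def)
    have cinner_A: "cinner (A n j h) k = (G h k (\<zeta> n j) + cnj (G k h (\<zeta> n j))) / 2" for n j h k
      unfolding A_def G_def g_def by (intro cinner_Re_op f_ops r_disc) simp
    have cinner_K: "cinner (K h) k = (G h k 0 - cnj (G k h 0)) / 2" for h k
      by (simp add: K_def minus_blinfun.rep_eq cinner_diff_left cinner_Re_op f_ops G_def g_def field_simps)
    have K: "K \<in> bounded_ops" and A: "A n j \<in> bounded_ops" for n j
      unfolding K_def A_def by (intro bounded_ops_diff Re_op_in_bounded_ops f_ops r_disc; simp)+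
    define F where "F n = op_comb K {..<n} (A n) (c n)" for n
    have cinner_Re_F: "cinner (Re_op (F n z) h) k = (\<Sum>j<n. complex_of_real (Re (c n j z)) * cinner (A n j h) k)"
      for n z h k
      unfolding F_def by (intro cinner_Re_op_comb K A) (simp_all add: cinner_K cinner_A field_simps)
    \<comment> \<open>The scalar limit applies with \<open>G h k\<close> and \<open>G k h\<close> as
      its two functions, since their half sum with the second one conjugated is the coefficient of
      \<open>A n j\<close>.\<close>
    have lim: "uniform_limit (cball 0 \<rho>) (\<lambda>n z. cinner (F n z h) k) (G h k) sequentially" for h k
      using uniform_limit_herglotz_sum [OF holG [of h k] holG [of k h] _ sub]
      by (simp add: F_def cinner_op_comb cinner_K cinner_A c_def \<zeta>_def)
    have "\<forall>\<^sub>F n in sequentially. \<forall>h\<in>S. \<forall>k\<in>S. \<forall>z\<in>cball 0 \<rho>. dist (cinner (F n z h) k) (G h k z) < e / 2"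
      using \<open>e > 0\<close> by (intro eventually_ball_ball_finite \<open>finite S\<close> uniform_limitD [OF lim]) simp
    then obtain n where n: "\<And>h k z. \<lbrakk>h \<in> S; k \<in> S; z \<in> cball 0 \<rho>\<rbrakk>
        \<Longrightarrow> dist (cinner (F n z h) k) (G h k z) < e / 2"
      using eventually_happens' [OF sequentially_bot] by blast
    have close: "cmod (cinner (F n z h) k - cinner (f z h) k) < e"
      if "h \<in> S" "k \<in> S" "z \<in> cball 0 \<rho>" for h k z
      using dist_triangle_half_l [OF n [OF that]] r_close [OF that]
      by (auto simp: dist_norm G_def g_def norm_minus_commute)
    have "F n \<in> herglotz_class"
      unfolding herglotz_class_def
    proof (intro CollectI conjI ballI)
      have "c n j holomorphic_on unit_disc" for j
      proof -
        have "\<zeta> n j \<noteq> z" if "z \<in> unit_disc" for z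
          using that by auto
        then show ?thesis
          unfolding c_def herglotz_kernel_def by (intro holomorphic_intros) auto
      qed
      then show "holomorphic_op_on (F n) unit_disc"
        unfolding F_def by (intro holomorphic_op_comb K A)
    next
      fix z assume "z \<in> unit_disc"
      \<comment> \<open>The weights are Poisson kernels divided by \<open>n\<close>, and each
        \<open>A n j\<close> is the real part of \<open>f\<close> at a point of the disc, so the
        quadratic form is a sum of nonnegative terms.\<close>
      then have "0 \<le> Re (c n j z)" for j
        by (simp add: c_def Re_divide_of_nat Re_herglotz_kernel abs_square_le_1)
      moreover have "cinner (A n j h) h \<in> \<real> \<and> 0 \<le> Re (cinner (A n j h) h)" for j h
        using f r_disc [of "\<zeta> n j"] by (simp add: A_def herglotz_class_def nonneg_op_def)
      ultimately show "nonneg_op (Re_op (F n z))"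
        unfolding nonneg_op_def cinner_Re_F by (auto intro!: sum_in_Reals Reals_mult sum_nonneg)
    qed
    \<comment> \<open>The exceptional set consists of the \<open>n\<close> sample points. At every
      other point of the circle the kernels are continuous, so the value of the formula itself is
      the boundary value.\<close>
    moreover have "AE \<xi> in arc_length. \<exists>B. boundary_value (F n) \<xi> B \<and> Re_op B = 0"
      using AE_arc_length [of "\<zeta> n ` {..<n}"]
    proof (rule eventually_mono [OF _ exI])
      fix \<xi> assume \<xi>: "cmod \<xi> = 1 \<and> \<xi> \<notin> \<zeta> n ` {..<n}"
      have "isCont (c n j) \<xi>" if "j < n" for j
        using that \<xi> unfolding c_def herglotz_kernel_def by (intro continuous_intros) auto
      moreover have "Re_op (F n \<xi>) = 0"
      proof (rule blinfun_eqI)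
        fix h
        \<comment> \<open>The numerator \<open>1 - (cmod \<xi>)\<^sup>2\<close> of the Poisson
          kernel vanishes on the circle.\<close>
        have "Re (c n j \<xi>) = 0" for j
          using \<xi> by (simp add: c_def Re_divide_of_nat Re_herglotz_kernel)
        then have "cinner (Re_op (F n \<xi>) h) (Re_op (F n \<xi>) h) = 0"
          by (simp add: cinner_Re_F)
        then show "Re_op (F n \<xi>) h = blinfun_apply 0 h"
          by (simp add: cinner_self)
      qed
      ultimately show "boundary_value (F n) \<xi> (F n \<xi>) \<and> Re_op (F n \<xi>) = 0"
        by (auto simp: F_def intro!: boundary_value_op_comb K A)
    qed simp
    ultimately show ?thesis
      using close by blast
  qed

  \<comment> \<open>Assembly of the net\<close>
  \<comment> \<open>An index \<open>(S, m)\<close> asks for precision \<open>1 / (m + 1)\<close> on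
    the disc of radius \<open>1 - 1 / (m + 1)\<close> for all vectors in \<open>S\<close>; the shift
    by one makes \<open>m = 0\<close> admissible. Unions and maxima give upper bounds.\<close>
  define I :: "('a set \<times> nat) set" where "I = Collect finite \<times> UNIV"
  define le :: "'a set \<times> nat \<Rightarrow> 'a set \<times> nat \<Rightarrow> bool"
    where "le i j \<longleftrightarrow> fst i \<subseteq> fst j \<and> snd i \<le> snd j" for i j
  have "\<forall>i\<in>I. \<exists>F. F \<in> herglotz_class \<and>
      (AE \<zeta> in arc_length. \<exists>A. boundary_value F \<zeta> A \<and> Re_op A = 0) \<and>
      (\<forall>h\<in>fst i. \<forall>k\<in>fst i. \<forall>z\<in>cball 0 (1 - 1 / real (Suc (snd i))).
         cmod (cinner (F z h) k - cinner (f z h) k) < 1 / real (Suc (snd i)))"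
    using approx unfolding I_def Bex_def by auto
  from bchoice [OF this] obtain F where "\<forall>i\<in>I. F i \<in> herglotz_class \<and>
      (AE \<zeta> in arc_length. \<exists>A. boundary_value (F i) \<zeta> A \<and> Re_op A = 0) \<and>
      (\<forall>h\<in>fst i. \<forall>k\<in>fst i. \<forall>z\<in>cball 0 (1 - 1 / real (Suc (snd i))).
         cmod (cinner (F i z h) k - cinner (f z h) k) < 1 / real (Suc (snd i)))" ..
  then have F: "\<And>i. i \<in> I \<Longrightarrow> F i \<in> herglotz_class"
      "\<And>i. i \<in> I \<Longrightarrow> AE \<zeta> in arc_length. \<exists>A. boundary_value (F i) \<zeta> A \<and> Re_op A = 0"
      "\<And>i h k z. \<lbrakk>i \<in> I; h \<in> fst i; k \<in> fst i; z \<in> cball 0 (1 - 1 / real (Suc (snd i)))\<rbrakk>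
        \<Longrightarrow> cmod (cinner (F i z h) k - cinner (f z h) k) < 1 / real (Suc (snd i))"
    by blast+
  have dir: "directed_set I le"
    unfolding directed_set_def
  proof (intro conjI ballI)
    fix i j assume "i \<in> I" "j \<in> I"
    then show "\<exists>k\<in>I. le i k \<and> le j k"
      by (intro bexI [of _ "(fst i \<union> fst j, max (snd i) (snd j))"]) (auto simp: I_def le_def)
  qed (auto simp: I_def le_def)
  have "uniform_limit K (\<lambda>i z. cinner (F i z h) k) (\<lambda>z. cinner (f z h) k) (net_filter I le)"
    if K: "compact K" "K \<subseteq> unit_disc" for h k K
  proof (rule uniform_limitI)
    fix e :: real assume "e > 0"
    \<comment> \<open>The modulus attains its maximum on a nonempty compact \<open>K\<close>, and
      this maximum is below 1; for empty \<open>K\<close> the radius 0 will do.\<close>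
    obtain \<rho> where \<rho>: "\<rho> < 1" "\<And>z. z \<in> K \<Longrightarrow> cmod z \<le> \<rho>"
    proof (cases "K = {}")
      case False
      then obtain w where "w \<in> K" "\<And>z. z \<in> K \<Longrightarrow> cmod z \<le> cmod w"
        using continuous_attains_sup [OF K(1), of cmod] by (auto intro: continuous_intros)
      then show ?thesis
        using that [of "cmod w"] K by auto
    qed (use that [of 0] in simp)
    \<comment> \<open>The minimum serves two ends: precision better than \<open>e\<close>, and a
      disc that contains \<open>K\<close>. The tail of the net then starts at
      \<open>({h, k}, n)\<close>.\<close>
    obtain n where n: "1 / real (Suc n) < min e (1 - \<rho>)"
      using nat_approx_posE [of "min e (1 - \<rho>)"] \<open>e > 0\<close> \<rho>(1) by (auto simp: field_simps)
    have "\<forall>z\<in>K. dist (cinner (F i z h) k) (cinner (f z h) k) < e"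
      if i: "i \<in> I" "le ({h, k}, n) i" for i
    proof
      fix z assume "z \<in> K"
      have "1 / real (Suc (snd i)) \<le> 1 / real (Suc n)"
        using i by (simp add: le_def frac_le)
      then have small: "1 / real (Suc (snd i)) < e" "1 / real (Suc (snd i)) < 1 - \<rho>"
        using n by auto
      have "cmod (cinner (F i z h) k - cinner (f z h) k) < 1 / real (Suc (snd i))"
        using i small \<rho>(2) [OF \<open>z \<in> K\<close>] by (intro F) (auto simp: le_def)
      then show "dist (cinner (F i z h) k) (cinner (f z h) k) < e"
        using small by (simp add: dist_norm)
    qed
    then show "\<forall>\<^sub>F i in net_filter I le. \<forall>z\<in>K. dist (cinner (F i z h) k) (cinner (f z h) k) < e"
      unfolding eventually_net_filter [OF dir] by (intro bexI [of _ "({h, k}, n)"]) (auto simp: I_def)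
  qed
  then have "wot_compactly_convergent F f (net_filter I le)"
    by (simp add: wot_compactly_convergent_def)
  then show ?thesis
    using F(1,2) dir by blast
qed

end
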